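(* Let $f_1,\dots,f_n:\mathbb{R}^d\to\mathbb{R}$ be such that each $f_i$ is proper, closed, convex, lower bounded, $L_i$-smooth for some $L_i>0$, and $\mu_i$-strongly convex for some $\mu_i>0$, and suppose that the problem of minimizing $f(x)=\sum_{i\in\mathcal{V}} f_i(x)$ over $x\in\mathbb{R}^d$ has a non-empty and bounded set of optimal solutions. Let $W=(w_{ij})\in\mathbb{R}^{n\times n}$ be an averaging matrix associated with the undirected connected graph $\mathcal{G}=(\mathcal{V},\mathcal{E})$. Suppose partial asynchrony holds, i.e. there exist positive integers $B$ and $D$ such that: 1) for every $i\in\mathcal{V}$ and every $k\ge 0$, at least one element of the set $\{k,\dots,k+B\}$ belongs to $\mathcal{K}_i$; 2) $k-D\le s_{ij}^k\le k$ for all $i\in\mathcal{V}$, $j\in\mathcal{N}_i$, and $k\in\mathcal{K}_i$. Suppose that the step-size satisfies $\alpha\in\big(0,2\min_{i\in\mathcal{V}}\frac{w_{ii}}{L_i}\big)$ in the asynchronous DGD and $\alpha\in\big(0,\frac{2}{\max_{i\in\mathcal{V}}L_i}\big)$ in the asynchronous DGD-ATC. Then $\{\mathbf{x}^k\}$ generated by either method (from an arbitrary initial point $\mathbf{x}^0\in\mathbb{R}^{nd}$) satisfies, for all $k\in\mathbb{N}_0$, $$\|\mathbf{x}^k-\mathbf{x}^\star\|_\infty^b\le\rho^{\lfloor k/(B+D+1)\rfloor}\,\|\mathbf{x}^0-\mathbf{x}^\star\|_\infty^b,$$ where $\mathbf{x}^\star$ is the fixed point of the synchronous counterpart of the method (that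 is, $\mathbf{x}^\star=\mathbf{W}\mathbf{x}^\star-\alpha\nabla F(\mathbf{x}^\star)$ for DGD and $\mathbf{x}^\star=\mathbf{W}(\mathbf{x}^\star-\alpha\nabla F(\mathbf{x}^\star))$ for DGD-ATC), and $\rho\in(0,1)$. Specifically, for the asynchronous DGD, $$\rho=\sqrt{1-\alpha\min_{i\in\mathcal{V}}\Big(\mu_i\Big(2-\frac{\alpha L_i}{w_{ii}}\Big)\Big)},$$ and for the asynchronous DGD-ATC, $$\rho=\sqrt{1-\alpha\min_{i\in\mathcal{V}}\big(\mu_i(2-\alpha L_i)\big)}.$$
   Context: Network: $\mathcal{G}=(\mathcal{V},\mathcal{E})$ is an undirected, connected graph with vertex set $\mathcal{V}=\{1,\dots,n\}$; $\mathcal{N}_i=\{j:\{i,j\}\in\mathcal{E}\}$ and $\bar{\mathcal{N}}_i=\mathcal{N}_i\cup\{i\}$. $\mathbb{N}_0$ denotes the natural numbers including $0$. A matrix $W=(w_{ij})\in\mathbb{R}^{n\times n}$ is an averaging matrix associated with $\mathcal{G}$ if it is entrywise non-negative, symmetric ($W=W^T$), stochastic ($W\mathbf{1}=\mathbf{1}$, with $\mathbf{1}$ the all-one vector), and satisfies $w_{ij}=0$ if and only if $\{i,j\}\notin\mathcal{E}$ and $i\neq j$. Put $\mathbf{W}=W\otimes I_d$ (Kronecker product). For $\mathbf{x}=(x_1^T,\dots,x_n^T)^T\in\mathbb{R}^{nd}$ with $x_i\in\mathbb{R}^d$, $F(\mathbf{x})=\sum_{i\in\mathcal{V}}f_i(x_i)$,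 and the block-wise maximum norm is $\|\mathbf{x}\|_\infty^b=\max_{i\in\mathcal{V}}\|x_i\|$, with $\|\cdot\|$ the $\ell_2$ norm. A differentiable $g:\mathbb{R}^d\to\mathbb{R}$ is $L$-smooth if $\|\nabla g(y)-\nabla g(x)\|\le L\|y-x\|$ for all $x,y\in\mathbb{R}^d$, and $\mu$-strongly convex if $\langle\nabla g(y)-\nabla g(x),y-x\rangle\ge\mu\|y-x\|^2$ for all $x,y\in\mathbb{R}^d$. Synchronous algorithms with step-size $\alpha>0$: DGD is $\mathbf{x}^{k+1}=\mathbf{W}\mathbf{x}^k-\alpha\nabla F(\mathbf{x}^k)$; DGD-ATC is $\mathbf{x}^{k+1}=\mathbf{W}(\mathbf{x}^k-\alpha\nabla F(\mathbf{x}^k))$. Asynchronous algorithms: for each $i\in\mathcal{V}$, $\mathcal{K}_i\subseteq\mathbb{N}_0$ is the set of iterations at which node $i$ updates; for $i\in\mathcal{V}$, $j\in\mathcal{N}_i$, $k\in\mathbb{N}_0$, $s_{ij}^k\in[0,k]$ is an integer (the iteration index of the most recent version of $x_j$ available to node $i$ at iteration $k$), and $s_{ii}^k=k$. The asynchronous DGD generates $\mathbf{x}^k=((x_1^k)^T,\dots,(x_n^k)^T)^T$ by, for each $i\in\mathcal{V}$ and $k\in\mathbb{N}_0$, $$x_i^{k+1}=\begin{cases}\sum_{j\in\bar{\mathcal{N}}_i}w_{ij}x_j^{s_{ij}^k}-\alpha\nabla f_i(x_i^k),&k\in\mathcal{K}_i,\\ x_i^k,&\text{otherwise.}\end{cases}$$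 The asynchronous DGD-ATC generates $\mathbf{x}^k$ by, for each $i\in\mathcal{V}$ and $k\in\mathbb{N}_0$, $$x_i^{k+1}=\begin{cases}\sum_{j\in\bar{\mathcal{N}}_i}w_{ij}\big(x_j^{s_{ij}^k}-\alpha\nabla f_j(x_j^{s_{ij}^k})\big),&k\in\mathcal{K}_i,\\ x_i^k,&\text{otherwise.}\end{cases}$$
   Formalization: The claim ρ∈(0,1) fails when μ_i=L_i=1/α for all i (for DGD also w_ii=1), where ρ=0; it is replaced by 0≤ρ<1, with ρ=0 exactly in that case. The rate bound is unchanged. *)

theory Defs
  imports "HOL-Analysis.Analysis"
begin

text \<open>
  The vertices are the elements of a finite type \<open>'n\<close>, the local variables live in
  \<open>real ^ 'd\<close>, and the stacked space R^(nd) is \<open>real ^ ('n \<times> 'd)\<close>: the pair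
  \<open>(i, l)\<close> indexes coordinate \<open>l\<close> of the block belonging to vertex \<open>i\<close>.
\<close>

subsection \<open>Network and averaging matrix\<close>

definition simple_graph :: "'n set set \<Rightarrow> bool" where
  "simple_graph E \<longleftrightarrow> (\<forall>e\<in>E. card e = 2)"

definition graph_connected :: "'n set set \<Rightarrow> bool" where
  "graph_connected E \<longleftrightarrow> (\<forall>i j. (i, j) \<in> {(u, v). {u, v} \<in> E}\<^sup>*)"

definition neighbours :: "'n set set \<Rightarrow> 'n \<Rightarrow> 'n set" where
  "neighbours E i = {j. {i, j} \<in> E}"

definition closed_neighbours :: "'n set set \<Rightarrow> 'n \<Rightarrow> 'n set" where
  "closed_neighbours E i = neighbours E i \<union> {i}"

text \<open>In \<open>W *v 1 = 1\<close> the symbol \<open>1\<close> is the all-one vector.\<close>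

definition averaging_matrix :: "'n set set \<Rightarrow> real ^ 'n ^ 'n::finite \<Rightarrow> bool" where
  "averaging_matrix E W \<longleftrightarrow>
     (\<forall>i j. 0 \<le> W $ i $ j) \<and>
     W = transpose W \<and>
     W *v 1 = 1 \<and>
     (\<forall>i j. W $ i $ j = 0 \<longleftrightarrow> {i, j} \<notin> E \<and> i \<noteq> j)"

subsection \<open>Stacked vectors\<close>

definition block :: "real ^ ('n::finite \<times> 'd::finite) \<Rightarrow> 'n \<Rightarrow> real ^ 'd" where
  "block x i = (\<chi> l. x $ (i, l))"

definition block_max_norm :: "real ^ ('n::finite \<times> 'd::finite) \<Rightarrow> real" where
  "block_max_norm x = Max (range (\<lambda>i. norm (block x i)))"

definition kronecker ::
  "real ^ 'n ^ 'm \<Rightarrow> real ^ 'q ^ 'p \<Rightarrow> real ^ ('n::finite \<times> 'q::finite) ^ ('m::finite \<times> 'p::finite)"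
  where "kronecker A B = (\<chi> r c. A $ fst r $ fst c * B $ snd r $ snd c)"

lemma block_kronecker_mat_1:
  "block (kronecker W (mat 1) *v x) i = (\<Sum>j\<in>UNIV. W $ i $ j *\<^sub>R block x j)"
proof -
  have "(\<Sum>c\<in>UNIV. W $ i $ fst c * (if l = snd c then 1 else 0) * x $ c)
      = (\<Sum>j\<in>UNIV. W $ i $ j * x $ (j, l))" for l
  proof -
    have "(\<Sum>c\<in>UNIV. W $ i $ fst c * (if l = snd c then 1 else 0) * x $ c)
        = (\<Sum>j\<in>UNIV. \<Sum>m\<in>UNIV. W $ i $ j * (if l = m then 1 else 0) * x $ (j, m))"
      unfolding sum.cartesian_product UNIV_Times_UNIV by (rule sum.cong) auto
    also have "\<dots> = (\<Sum>j\<in>UNIV. W $ i $ j * x $ (j, l))"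
    proof (rule sum.cong [OF refl])
      fix j
      have "(\<Sum>m\<in>UNIV. W $ i $ j * (if l = m then 1 else 0) * x $ (j, m))
          = (\<Sum>m\<in>UNIV. if l = m then W $ i $ j * x $ (j, m) else 0)"
        by (rule sum.cong) auto
      then show "(\<Sum>m\<in>UNIV. W $ i $ j * (if l = m then 1 else 0) * x $ (j, m))
          = W $ i $ j * x $ (j, l)"
        by simp
    qed
    finally show ?thesis .
  qed
  then show ?thesis
    unfolding vec_eq_iff block_def kronecker_def matrix_vector_mult_def mat_def
    by simp
qed

subsection \<open>Objective functions\<close>

definition gradient :: "('a::real_inner \<Rightarrow> real) \<Rightarrow> 'a \<Rightarrow> 'a" where
  "gradient g x = (THE D. GDERIV g x :> D)"

lemma gradient_eqI:
  assumes "GDERIV g x :> D"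
  shows "gradient g x = D"
  unfolding gradient_def
proof (rule the_equality)
  fix D' assume "GDERIV g x :> D'"
  with assms have "(\<lambda>h. h \<bullet> D') = (\<lambda>h. h \<bullet> D)"
    unfolding gderiv_def by (rule has_derivative_unique [rotated])
  then show "D' = D"
    by (simp add: fun_eq_iff vector_eq_ldot)
qed (fact assms)

text \<open>Properness and closedness are notions for extended-real-valued functions; a real-valued
  function is embedded via \<open>ereal\<close> for the former, and has its epigraph in \<open>'a \<times> real\<close> for the
  latter.\<close>

definition proper_function :: "('a \<Rightarrow> ereal) \<Rightarrow> bool" where
  "proper_function g \<longleftrightarrow> (\<forall>x. g x \<noteq> -\<infinity>) \<and> (\<exists>x. g x \<noteq> \<infinity>)"

definition closed_function :: "('a::euclidean_space \<Rightarrow> real) \<Rightarrow> bool" where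
  "closed_function g \<longleftrightarrow> closed (epigraph UNIV g)"

definition L_smooth :: "real \<Rightarrow> ('a::euclidean_space \<Rightarrow> real) \<Rightarrow> bool" where
  "L_smooth L g \<longleftrightarrow> (\<forall>x. g differentiable (at x)) \<and>
     (\<forall>x y. norm (gradient g y - gradient g x) \<le> L * norm (y - x))"

definition strongly_convex :: "real \<Rightarrow> ('a::euclidean_space \<Rightarrow> real) \<Rightarrow> bool" where
  "strongly_convex \<mu> g \<longleftrightarrow> (\<forall>x. g differentiable (at x)) \<and>
     (\<forall>x y. (gradient g y - gradient g x) \<bullet> (y - x) \<ge> \<mu> * (norm (y - x))\<^sup>2)"

definition optimal_solutions :: "('a \<Rightarrow> real) \<Rightarrow> 'a set" where
  "optimal_solutions g = {x. \<forall>y. g x \<le> g y}"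

definition stacked_objective ::
  "('n::finite \<Rightarrow> real ^ 'd::finite \<Rightarrow> real) \<Rightarrow> real ^ ('n \<times> 'd) \<Rightarrow> real" where
  "stacked_objective f x = (\<Sum>i\<in>UNIV. f i (block x i))"

subsection \<open>Synchronous iteration maps\<close>

definition dgd_map ::
  "real ^ 'n ^ 'n \<Rightarrow> ('n::finite \<Rightarrow> real ^ 'd::finite \<Rightarrow> real) \<Rightarrow> real \<Rightarrow>
    real ^ ('n \<times> 'd) \<Rightarrow> real ^ ('n \<times> 'd)" where
  "dgd_map W f \<alpha> x = kronecker W (mat 1) *v x - \<alpha> *\<^sub>R gradient (stacked_objective f) x"

definition dgd_atc_map ::
  "real ^ 'n ^ 'n \<Rightarrow> ('n::finite \<Rightarrow> real ^ 'd::finite \<Rightarrow> real) \<Rightarrow> real \<Rightarrow>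
    real ^ ('n \<times> 'd) \<Rightarrow> real ^ ('n \<times> 'd)" where
  "dgd_atc_map W f \<alpha> x = kronecker W (mat 1) *v (x - \<alpha> *\<^sub>R gradient (stacked_objective f) x)"

subsection \<open>Asynchronous iterations\<close>

text \<open>\<open>s i j k\<close> is the iteration index of the version of block \<open>j\<close> that vertex \<open>i\<close> has at
  iteration \<open>k\<close>; \<open>K i\<close> is the set of iterations at which vertex \<open>i\<close> updates.\<close>

definition valid_delays :: "'n set set \<Rightarrow> ('n \<Rightarrow> 'n \<Rightarrow> nat \<Rightarrow> nat) \<Rightarrow> bool" where
  "valid_delays E s \<longleftrightarrow>
     (\<forall>i. \<forall>j\<in>neighbours E i. \<forall>k. s i j k \<le> k) \<and> (\<forall>i k. s i i k = k)"

definition partial_asynchrony ::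
  "'n set set \<Rightarrow> ('n \<Rightarrow> nat set) \<Rightarrow> ('n \<Rightarrow> 'n \<Rightarrow> nat \<Rightarrow> nat) \<Rightarrow> nat \<Rightarrow> nat \<Rightarrow> bool" where
  "partial_asynchrony E K s B D \<longleftrightarrow>
     (\<forall>i k. {k..k + B} \<inter> K i \<noteq> {}) \<and>
     (\<forall>i. \<forall>j\<in>neighbours E i. \<forall>k\<in>K i. int k - int D \<le> int (s i j k) \<and> s i j k \<le> k)"

definition async_dgd ::
  "'n set set \<Rightarrow> real ^ 'n ^ 'n \<Rightarrow> ('n::finite \<Rightarrow> real ^ 'd::finite \<Rightarrow> real) \<Rightarrow> real \<Rightarrow>
    ('n \<Rightarrow> nat set) \<Rightarrow> ('n \<Rightarrow> 'n \<Rightarrow> nat \<Rightarrow> nat) \<Rightarrow> (nat \<Rightarrow> real ^ ('n \<times> 'd)) \<Rightarrow> bool" where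
  "async_dgd E W f \<alpha> K s x \<longleftrightarrow>
     (\<forall>i k. block (x (Suc k)) i =
        (if k \<in> K i
         then (\<Sum>j\<in>closed_neighbours E i. W $ i $ j *\<^sub>R block (x (s i j k)) j)
              - \<alpha> *\<^sub>R gradient (f i) (block (x k) i)
         else block (x k) i))"

definition async_dgd_atc ::
  "'n set set \<Rightarrow> real ^ 'n ^ 'n \<Rightarrow> ('n::finite \<Rightarrow> real ^ 'd::finite \<Rightarrow> real) \<Rightarrow> real \<Rightarrow>
    ('n \<Rightarrow> nat set) \<Rightarrow> ('n \<Rightarrow> 'n \<Rightarrow> nat \<Rightarrow> nat) \<Rightarrow> (nat \<Rightarrow> real ^ ('n \<times> 'd)) \<Rightarrow> bool" where
  "async_dgd_atc E W f \<alpha> K s x \<longleftrightarrow>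
     (\<forall>i k. block (x (Suc k)) i =
        (if k \<in> K i
         then (\<Sum>j\<in>closed_neighbours E i. W $ i $ j *\<^sub>R
                 (block (x (s i j k)) j - \<alpha> *\<^sub>R gradient (f j) (block (x (s i j k)) j)))
         else block (x k) i))"

subsection \<open>Contraction factors\<close>

definition rho_dgd ::
  "real ^ 'n ^ 'n \<Rightarrow> ('n::finite \<Rightarrow> real) \<Rightarrow> ('n \<Rightarrow> real) \<Rightarrow> real \<Rightarrow> real" where
  "rho_dgd W \<mu> L \<alpha> = sqrt (1 - \<alpha> * Min (range (\<lambda>i. \<mu> i * (2 - \<alpha> * L i / W $ i $ i))))"

definition rho_dgd_atc :: "('n::finite \<Rightarrow> real) \<Rightarrow> ('n \<Rightarrow> real) \<Rightarrow> real \<Rightarrow> real" where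
  "rho_dgd_atc \<mu> L \<alpha> = sqrt (1 - \<alpha> * Min (range (\<lambda>i. \<mu> i * (2 - \<alpha> * L i))))"

end

theory Submission
  imports Defs
begin

text \<open>
  Both methods update vertex \<open>i\<close> by a map \<open>U i\<close> that reads only the blocks of the closed
  neighbourhood of \<open>i\<close>, and everything rests on one property of these maps
  (\<open>block_contraction\<close>): if the blocks that are read have distance at most \<open>M\<close> to those of a
  second configuration, the new values have distance at most \<open>\<rho> * M\<close>.

  Where this comes from: the gradient of a convex \<open>L\<close>-smooth function is cocoercive
  (\<open>gradient_cocoercive\<close>).  Together with strong convexity it makes a gradient step of length
  \<open>\<beta> < 2 / L\<close> contract squared distances by \<open>1 - \<beta> \<mu> (2 - \<beta> L)\<close>
  (\<open>gradient_step_contracts\<close>).  DGD-ATC averages such steps, so it inherits the worst of their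
  factors.  In DGD only the own block, of weight \<open>w\<close>, takes part in the gradient term: it is
  \<open>w\<close> times a gradient step of length \<open>\<alpha> / w\<close>, and convexity of the square turns its
  factor into \<open>1 - \<alpha> \<mu> (2 - \<alpha> L / w)\<close> for the whole average.

  What it gives: the synchronous map is a contraction of the block maximum norm, hence it has a
  unique fixed point (\<open>block_contraction_unique_fixpoint\<close>).  In the asynchronous iteration
  (\<open>block_contraction_async_rate\<close>) the initial error bounds all later ones, since \<open>\<rho> \<le> 1\<close>.
  Once every error stays below \<open>M\<close>, all information in use is subject to this bound after \<open>D\<close> further iterations, and
  every vertex uses it within the next \<open>B + 1\<close> iterations.  So each window of \<open>B + D + 1\<close>
  iterations gains one factor \<open>\<rho>\<close>.
\<close>

section \<open>Gradient steps on smooth strongly convex functions\<close>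

lemma differentiable_imp_GDERIV_gradient:
  fixes g :: "'a::euclidean_space \<Rightarrow> real"
  assumes "g differentiable (at x)"
  shows "GDERIV g x :> gradient g x"
proof -
  obtain g' where g': "(g has_derivative g') (at x)"
    using assms unfolding differentiable_def by blast
  then have "linear g'"
    by (rule has_derivative_linear)
  have "g' = (\<lambda>h. h \<bullet> (\<Sum>b\<in>Basis. g' b *\<^sub>R b))"
  proof
    fix h
    show "g' h = h \<bullet> (\<Sum>b\<in>Basis. g' b *\<^sub>R b)"
      using Linear_Algebra.linear_componentwise[OF \<open>linear g'\<close>, of h 1]
      by (simp add: inner_sum_right mult.commute)
  qed
  then have "GDERIV g x :> (\<Sum>b\<in>Basis. g' b *\<^sub>R b)"
    using g' unfolding gderiv_def by simp
  then show ?thesis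
    using gradient_eqI by metis
qed

text \<open>Growth of the gradient along a segment, integrated: the derivative of \<open>g\<close> along the segment
  exceeds its initial value by at most \<open>c * t\<close>.  With \<open>c = L * (norm v)\<^sup>2\<close> this is the descent lemma
  for smooth functions; with \<open>c = 0\<close>, applied to \<open>- g\<close>, it is the first-order lower bound for
  convex ones.\<close>

lemma GDERIV_segment_upper_bound:
  fixes g :: "'a::real_inner \<Rightarrow> real"
  assumes G: "\<And>z. GDERIV g z :> G z"
    and growth: "\<And>t. \<lbrakk>0 \<le> t; t \<le> 1\<rbrakk> \<Longrightarrow> (G (x + t *\<^sub>R v) - G x) \<bullet> v \<le> c * t"
  shows "g (x + v) \<le> g x + G x \<bullet> v + c / 2"
proof -
  define \<phi> where "\<phi> t = g (x + t *\<^sub>R v) - t * (G x \<bullet> v) - c * t\<^sup>2 / 2" for t :: real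
  have deriv: "(\<phi> has_real_derivative (G (x + t *\<^sub>R v) - G x) \<bullet> v - c * t) (at t)" for t
  proof -
    have "((\<lambda>t. x + t *\<^sub>R v) has_derivative (\<lambda>r. r *\<^sub>R v)) (at t)"
      by (auto intro!: derivative_eq_intros)
    from has_derivative_compose[OF this G[of "x + t *\<^sub>R v", unfolded gderiv_def]]
    have "((\<lambda>t. g (x + t *\<^sub>R v)) has_real_derivative v \<bullet> G (x + t *\<^sub>R v)) (at t)"
      by (simp add: has_field_derivative_def mult.commute mult_commute_abs)
    then show ?thesis
      unfolding \<phi>_def
      by (auto intro!: derivative_eq_intros simp: inner_diff_left inner_diff_right inner_commute)
  qed
  have "\<phi> 1 \<le> \<phi> 0"
  proof (rule DERIV_nonpos_imp_nonincreasing[where f = \<phi>])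
    fix t :: real assume "0 \<le> t" "t \<le> 1"
    then show "\<exists>y. (\<phi> has_real_derivative y) (at t) \<and> y \<le> 0"
      using deriv[of t] growth[of t] by auto
  qed simp
  then show ?thesis
    by (simp add: \<phi>_def)
qed

text \<open>The Baillon-Haddad inequality.  The function \<open>z \<mapsto> g z - G x \<bullet> z\<close> is convex and minimal at
  \<open>x\<close>; a gradient step of length \<open>1 / L\<close> from \<open>y\<close> lowers it by at least
  \<open>(norm (G y - G x))\<^sup>2 / (2 * L)\<close>, so its values at \<open>x\<close> and \<open>y\<close> differ by at least that much.
  Exchanging \<open>x\<close> and \<open>y\<close> and adding gives the claim.\<close>

lemma gradient_cocoercive:
  fixes g :: "'a::real_inner \<Rightarrow> real"
  assumes G: "\<And>z. GDERIV g z :> G z"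
    and "L > 0"
    and lipschitz: "\<And>x y. norm (G y - G x) \<le> L * norm (y - x)"
    and monotone: "\<And>x y. 0 \<le> (G y - G x) \<bullet> (y - x)"
  shows "(norm (G y - G x))\<^sup>2 \<le> L * ((G y - G x) \<bullet> (y - x))"
proof -
  have convex: "g x + G x \<bullet> v \<le> g (x + v)" for x v
  proof -
    have "- g (x + v) \<le> - g x + - G x \<bullet> v + 0 / 2"
    proof (rule GDERIV_segment_upper_bound[of "\<lambda>z. - g z" "\<lambda>z. - G z"])
      show "GDERIV (\<lambda>z. - g z) z :> - G z" for z
        using G by (rule GDERIV_minus)
      fix t :: real assume "0 \<le> t" "t \<le> 1"
      have "0 \<le> (G (x + t *\<^sub>R v) - G x) \<bullet> v"
      proof (cases "t = 0")
        case False
        then show ?thesis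
          using monotone[of "x + t *\<^sub>R v" x] \<open>0 \<le> t\<close> by (simp add: zero_le_mult_iff)
      qed simp
      then show "(- G (x + t *\<^sub>R v) - - G x) \<bullet> v \<le> 0 * t"
        by (simp add: inner_diff_left)
    qed
    then show ?thesis
      by simp
  qed
  have descent: "g (x + v) \<le> g x + G x \<bullet> v + L * (norm v)\<^sup>2 / 2" for x v
  proof (rule GDERIV_segment_upper_bound[OF G])
    fix t :: real assume t: "0 \<le> t" "t \<le> 1"
    have "(G (x + t *\<^sub>R v) - G x) \<bullet> v \<le> norm (G (x + t *\<^sub>R v) - G x) * norm v"
      by (rule norm_cauchy_schwarz)
    also have "\<dots> \<le> (L * norm (t *\<^sub>R v)) * norm v"
      using lipschitz[of "x + t *\<^sub>R v" x] by (intro mult_right_mono) auto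
    finally show "(G (x + t *\<^sub>R v) - G x) \<bullet> v \<le> L * (norm v)\<^sup>2 * t"
      using t by (simp add: power2_eq_square mult_ac)
  qed
  have half: "g x + G x \<bullet> (y - x) + (norm (G y - G x))\<^sup>2 / (2 * L) \<le> g y" for x y
  proof -
    define \<Delta> where "\<Delta> = G y - G x"
    define v where "v = - (1 / L) *\<^sub>R \<Delta>"
    have "g x + G x \<bullet> (y + v - x) \<le> g (y + v)"
      using convex[of x "y + v - x"] by simp
    also have "\<dots> \<le> g y + G y \<bullet> v + L * (norm v)\<^sup>2 / 2"
      by (rule descent)
    finally have "g x + G x \<bullet> (y - x) \<le> g y + \<Delta> \<bullet> v + L * (norm v)\<^sup>2 / 2"
      by (simp add: \<Delta>_def inner_diff_left inner_diff_right inner_add_right)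
    moreover have "\<Delta> \<bullet> v = - ((norm \<Delta>)\<^sup>2 / L)"
      by (simp add: v_def power2_norm_eq_inner)
    moreover have "L * (norm v)\<^sup>2 / 2 = (norm \<Delta>)\<^sup>2 / (2 * L)"
      using \<open>L > 0\<close> by (simp add: v_def power_divide power2_eq_square)
    moreover have "(norm \<Delta>)\<^sup>2 / L = 2 * ((norm \<Delta>)\<^sup>2 / (2 * L))"
      by simp
    ultimately show ?thesis
      unfolding \<Delta>_def by linarith
  qed
  have "2 * ((norm (G y - G x))\<^sup>2 / (2 * L)) \<le> (G y - G x) \<bullet> (y - x)"
    using half[of x y] half[of y x]
    by (simp add: norm_minus_commute inner_diff_left inner_diff_right)
  then show ?thesis
    using \<open>L > 0\<close> by (simp add: field_simps)
qed

text \<open>Expanding the square leaves \<open>- 2 \<beta> \<Delta> \<bullet> u + \<beta>\<^sup>2 (norm \<Delta>)\<^sup>2\<close>, where \<open>\<Delta>\<close> is the difference of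
  the gradients and \<open>u = y - x\<close>.  Cocoercivity absorbs the second term, and strong convexity
  bounds \<open>\<Delta> \<bullet> u\<close> in what remains.\<close>

lemma gradient_step_contracts:
  fixes g :: "'a::euclidean_space \<Rightarrow> real"
  assumes smooth: "L_smooth L g" and strong: "strongly_convex \<mu> g"
    and "L > 0" "\<mu> > 0" and \<beta>: "\<beta> > 0" "\<beta> * L < 2"
  shows "(norm ((y - \<beta> *\<^sub>R gradient g y) - (x - \<beta> *\<^sub>R gradient g x)))\<^sup>2
       \<le> (1 - \<beta> * \<mu> * (2 - \<beta> * L)) * (norm (y - x))\<^sup>2"
proof -
  define \<Delta> where "\<Delta> = gradient g y - gradient g x"
  have monotone: "0 \<le> (gradient g y - gradient g x) \<bullet> (y - x)" for x y
    using strong \<open>\<mu> > 0\<close> unfolding strongly_convex_def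
    by (meson less_imp_le mult_nonneg_nonneg order_trans zero_le_power2)
  have "(norm \<Delta>)\<^sup>2 \<le> L * (\<Delta> \<bullet> (y - x))"
    unfolding \<Delta>_def
  proof (rule gradient_cocoercive)
    show "GDERIV g z :> gradient g z" for z
      using smooth unfolding L_smooth_def by (blast intro: differentiable_imp_GDERIV_gradient)
    show "norm (gradient g y - gradient g x) \<le> L * norm (y - x)" for x y
      using smooth unfolding L_smooth_def by blast
  qed (fact \<open>L > 0\<close> monotone)+
  then have coco: "\<beta>\<^sup>2 * (norm \<Delta>)\<^sup>2 \<le> \<beta>\<^sup>2 * (L * (\<Delta> \<bullet> (y - x)))"
    by (rule mult_left_mono) simp
  have "\<mu> * (norm (y - x))\<^sup>2 \<le> \<Delta> \<bullet> (y - x)"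
    using strong unfolding strongly_convex_def \<Delta>_def by blast
  then have strong': "\<beta> * (2 - \<beta> * L) * (\<mu> * (norm (y - x))\<^sup>2) \<le> \<beta> * (2 - \<beta> * L) * (\<Delta> \<bullet> (y - x))"
    using \<beta> by (intro mult_left_mono) auto
  have "(norm ((y - \<beta> *\<^sub>R gradient g y) - (x - \<beta> *\<^sub>R gradient g x)))\<^sup>2
      = (norm ((y - x) - \<beta> *\<^sub>R \<Delta>))\<^sup>2"
    by (simp add: \<Delta>_def algebra_simps)
  also have "\<dots> = (norm (y - x))\<^sup>2 - 2 * \<beta> * (\<Delta> \<bullet> (y - x)) + \<beta>\<^sup>2 * (norm \<Delta>)\<^sup>2"
    unfolding power2_norm_eq_inner
    by (simp add: inner_diff_left inner_diff_right inner_commute power2_eq_square algebra_simps)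
  also have "\<dots> \<le> (norm (y - x))\<^sup>2 - \<beta> * (2 - \<beta> * L) * (\<Delta> \<bullet> (y - x))"
    using coco by (simp add: algebra_simps power2_eq_square)
  also have "\<dots> \<le> (1 - \<beta> * \<mu> * (2 - \<beta> * L)) * (norm (y - x))\<^sup>2"
    using strong' by (simp add: algebra_simps)
  finally show ?thesis .
qed

lemma strongly_convex_modulus_le_smoothness:
  fixes g :: "'a::euclidean_space \<Rightarrow> real"
  assumes smooth: "L_smooth L g" and strong: "strongly_convex \<mu> g"
  shows "\<mu> \<le> L"
proof -
  obtain b :: 'a where "b \<in> Basis"
    using nonempty_Basis by blast
  then have "norm b = 1"
    by simp
  have "\<mu> * (norm (b - 0))\<^sup>2 \<le> (gradient g b - gradient g 0) \<bullet> (b - 0)"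
    using strong unfolding strongly_convex_def by blast
  also have "\<dots> \<le> norm (gradient g b - gradient g 0) * norm (b - 0)"
    by (rule norm_cauchy_schwarz)
  also have "\<dots> \<le> (L * norm (b - 0)) * norm (b - 0)"
    using smooth unfolding L_smooth_def by (intro mult_right_mono) (blast, simp)
  finally show ?thesis
    using \<open>norm b = 1\<close> by simp
qed

section \<open>The contraction factor\<close>

text \<open>With \<open>t = \<alpha> * L / v\<close> and \<open>\<mu> \<le> L\<close>, the term is at most \<open>v * t * (2 - t)\<close>, which is at most
  \<open>v \<le> 1\<close>; it equals \<open>1\<close> precisely when all three of these inequalities are equalities.\<close>

lemma contraction_factor_term:
  fixes \<alpha> \<mu> L v :: real
  assumes "\<alpha> > 0" "\<mu> > 0" "\<mu> \<le> L" "0 < v" "v \<le> 1" "\<alpha> * L < 2 * v"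
  shows "0 < \<alpha> * (\<mu> * (2 - \<alpha> * L / v))"
    and "\<alpha> * (\<mu> * (2 - \<alpha> * L / v)) \<le> 1"
    and "\<alpha> * (\<mu> * (2 - \<alpha> * L / v)) = 1 \<longleftrightarrow> v = 1 \<and> \<mu> = L \<and> \<alpha> = 1 / L"
proof -
  define t where "t = \<alpha> * L / v"
  have t: "0 < t" "t < 2" and \<alpha>L: "\<alpha> * L = v * t"
    using assms by (auto simp: t_def field_simps)
  show "0 < \<alpha> * (\<mu> * (2 - \<alpha> * L / v))"
    using assms t by (simp add: t_def)
  have "\<alpha> * (\<mu> * (2 - t)) \<le> \<alpha> * (L * (2 - t))"
    using assms t by (intro mult_left_mono mult_right_mono) auto
  also have "\<dots> = v * t * (2 - t)"
    by (simp flip: \<alpha>L)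
  also have "\<dots> = v - v * (1 - t)\<^sup>2"
    by (simp add: power2_eq_square algebra_simps)
  finally have *: "\<alpha> * (\<mu> * (2 - t)) \<le> v - v * (1 - t)\<^sup>2" .
  have sq: "0 \<le> v * (1 - t)\<^sup>2"
    using assms by simp
  with * assms show "\<alpha> * (\<mu> * (2 - \<alpha> * L / v)) \<le> 1"
    unfolding t_def by linarith
  show "\<alpha> * (\<mu> * (2 - \<alpha> * L / v)) = 1 \<longleftrightarrow> v = 1 \<and> \<mu> = L \<and> \<alpha> = 1 / L"
  proof
    assume "\<alpha> * (\<mu> * (2 - \<alpha> * L / v)) = 1"
    then have eq: "\<alpha> * (\<mu> * (2 - t)) = 1"
      by (simp add: t_def)
    with * sq \<open>v \<le> 1\<close> have "v = 1" "v * (1 - t)\<^sup>2 = 0"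
      by linarith+
    then have "t = 1"
      by simp
    then have "\<alpha> * \<mu> = 1" "\<alpha> * L = 1"
      using eq \<alpha>L \<open>v = 1\<close> by simp_all
    moreover from this have "\<mu> = L"
      using \<open>\<alpha> > 0\<close> by (metis mult_left_cancel less_irrefl)
    ultimately show "v = 1 \<and> \<mu> = L \<and> \<alpha> = 1 / L"
      using \<open>v = 1\<close> assms by (auto simp: field_simps)
  next
    assume "v = 1 \<and> \<mu> = L \<and> \<alpha> = 1 / L"
    then show "\<alpha> * (\<mu> * (2 - \<alpha> * L / v)) = 1"
      using assms by auto
  qed
qed

text \<open>The common form of both factors: \<open>v i\<close> is the weight of the own block in DGD and \<open>1\<close> in
  DGD-ATC.  Since none of the terms exceeds \<open>1\<close>, the factor vanishes only if all of them,
  and not just the minimal one, are equal to \<open>1\<close>.\<close>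

lemma contraction_factor:
  fixes \<mu> L v :: "'n::finite \<Rightarrow> real"
    and \<alpha> :: real
  defines "r \<equiv> sqrt (1 - \<alpha> * Min (range (\<lambda>i. \<mu> i * (2 - \<alpha> * L i / v i))))"
  assumes "\<alpha> > 0" and "\<And>i. \<mu> i > 0" and "\<And>i. \<mu> i \<le> L i"
    and "\<And>i. 0 < v i" and "\<And>i. v i \<le> 1" and "\<And>i. \<alpha> * L i < 2 * v i"
  shows "0 \<le> r" and "r < 1"
    and "r = 0 \<longleftrightarrow> (\<forall>i. v i = 1 \<and> \<mu> i = L i \<and> \<alpha> = 1 / L i)"
    and "1 - \<alpha> * \<mu> i * (2 - \<alpha> * L i / v i) \<le> r\<^sup>2"
proof -
  let ?c = "\<lambda>i. \<mu> i * (2 - \<alpha> * L i / v i)"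
  define m where "m = Min (range ?c)"
  have "m \<in> range ?c"
    unfolding m_def by (rule Min_in) auto
  then obtain i0 where i0: "m = ?c i0"
    by blast
  have m_le: "m \<le> ?c i" for i
    unfolding m_def by (rule Min_le) auto
  note terms = contraction_factor_term[of \<alpha> "\<mu> i" "L i" "v i" for i, OF assms(2-7)]
  have m: "0 < \<alpha> * m" "\<alpha> * m \<le> 1"
    using terms(1,2)[of i0] i0 by simp_all
  show "0 \<le> r" "r < 1"
    using m by (simp_all add: r_def flip: m_def)
  have "r = 0 \<longleftrightarrow> \<alpha> * m = 1"
    by (auto simp: r_def simp flip: m_def)
  also have "\<dots> \<longleftrightarrow> (\<forall>i. \<alpha> * ?c i = 1)"
  proof
    assume "\<alpha> * m = 1"
    then show "\<forall>i. \<alpha> * ?c i = 1"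
      using terms(2) m_le mult_left_mono[OF m_le, of \<alpha>] \<open>\<alpha> > 0\<close> by (metis less_imp_le order_antisym)
  next
    assume "\<forall>i. \<alpha> * ?c i = 1"
    then show "\<alpha> * m = 1"
      using i0 by simp
  qed
  also have "\<dots> \<longleftrightarrow> (\<forall>i. v i = 1 \<and> \<mu> i = L i \<and> \<alpha> = 1 / L i)"
    using terms(3) by simp
  finally show "r = 0 \<longleftrightarrow> (\<forall>i. v i = 1 \<and> \<mu> i = L i \<and> \<alpha> = 1 / L i)" .
  have "r\<^sup>2 = 1 - \<alpha> * m"
    using m by (simp add: r_def flip: m_def)
  then show "1 - \<alpha> * \<mu> i * (2 - \<alpha> * L i / v i) \<le> r\<^sup>2"
    using mult_left_mono[OF m_le, of \<alpha> i] \<open>\<alpha> > 0\<close> by (simp add: mult.assoc)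
qed

section \<open>Local updates that contract the blocks they read\<close>

text \<open>\<open>U i y\<close> is the value that vertex \<open>i\<close> computes when it reads the block \<open>y j\<close> of vertex \<open>j\<close>.
  A family of blocks, rather than a stacked vector, is the argument because the blocks read in an
  asynchronous step come from different iterations.\<close>

definition block_contraction ::
  "'n set set \<Rightarrow> real \<Rightarrow> ('n \<Rightarrow> ('n \<Rightarrow> 'a::real_normed_vector) \<Rightarrow> 'a) \<Rightarrow> bool" where
  "block_contraction E \<rho> U \<longleftrightarrow>
     (\<forall>i y z M. (\<forall>j\<in>closed_neighbours E i. norm (y j - z j) \<le> M) \<longrightarrow>
        norm (U i y - U i z) \<le> \<rho> * M)"

lemma block_diff: "block (x - y) i = block x i - block y i"
  by (simp add: block_def vec_eq_iff)

lemma norm_block_le: "norm (block x i) \<le> block_max_norm x"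
  unfolding block_max_norm_def by (rule Max_ge) auto

lemma block_max_norm_le_iff: "block_max_norm x \<le> M \<longleftrightarrow> (\<forall>i. norm (block x i) \<le> M)"
  unfolding block_max_norm_def by (subst Max_le_iff) auto

lemma block_max_norm_nonneg: "0 \<le> block_max_norm x"
  using norm_block_le order_trans norm_ge_zero by blast

lemma norm_le_block_max_norm:
  fixes x :: "real ^ ('n::finite \<times> 'd::finite)"
  shows "norm x \<le> CARD('n \<times> 'd) * block_max_norm x"
proof -
  have component: "\<bar>x $ p\<bar> \<le> block_max_norm x" for p
  proof -
    have "\<bar>x $ p\<bar> = \<bar>block x (fst p) $ snd p\<bar>"
      by (simp add: block_def)
    also have "\<dots> \<le> norm (block x (fst p))"
      by (rule component_le_norm_cart)
    finally show ?thesis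
      using norm_block_le order_trans by blast
  qed
  have "norm x \<le> (\<Sum>p\<in>UNIV. \<bar>x $ p\<bar>)"
    by (rule norm_le_l1_cart)
  also have "\<dots> \<le> CARD('n \<times> 'd) * block_max_norm x"
    by (rule sum_bounded_above) (rule component)
  finally show ?thesis .
qed

lemma block_max_norm_le_norm:
  fixes x :: "real ^ ('n::finite \<times> 'd::finite)"
  shows "block_max_norm x \<le> CARD('d) * norm x"
  unfolding block_max_norm_le_iff
proof
  fix i
  have "norm (block x i) \<le> (\<Sum>l\<in>UNIV. \<bar>block x i $ l\<bar>)"
    by (rule norm_le_l1_cart)
  also have "\<dots> \<le> CARD('d) * norm x"
    by (rule sum_bounded_above) (simp add: block_def component_le_norm_cart)
  finally show "norm (block x i) \<le> CARD('d) * norm x" .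
qed

text \<open>The map need not contract the Euclidean norm, but the two norms are equivalent, so a high
  iterate of it does.  The fixed point of that iterate is unique and therefore also fixed by the
  map itself.\<close>

lemma block_contraction_unique_fixpoint:
  fixes T :: "real ^ ('n::finite \<times> 'd::finite) \<Rightarrow> real ^ ('n \<times> 'd)"
  assumes U: "block_contraction E \<rho> U" and \<rho>: "0 \<le> \<rho>" "\<rho> < 1"
    and T: "\<And>x i. block (T x) i = U i (block x)"
  shows "\<exists>!x. x = T x"
proof -
  have step: "block_max_norm (T x - T y) \<le> \<rho> * block_max_norm (x - y)" for x y
    unfolding block_max_norm_le_iff[of "T x - T y"]
    using U norm_block_le[of "x - y"] unfolding block_contraction_def
    by (simp add: T block_diff)
  have steps: "block_max_norm ((T ^^ N) x - (T ^^ N) y) \<le> \<rho> ^ N * block_max_norm (x - y)" for N x y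
  proof (induction N)
    case (Suc N)
    have "block_max_norm ((T ^^ Suc N) x - (T ^^ Suc N) y)
        \<le> \<rho> * block_max_norm ((T ^^ N) x - (T ^^ N) y)"
      using step by simp
    also have "\<dots> \<le> \<rho> * (\<rho> ^ N * block_max_norm (x - y))"
      using Suc.IH \<rho>(1) by (rule mult_left_mono)
    finally show ?case
      by (simp add: mult.assoc)
  qed simp
  define C where "C = real CARD('n \<times> 'd) * real CARD('d)"
  have "C > 0"
    by (simp add: C_def)
  then obtain N where N: "\<rho> ^ N < 1 / C"
    using real_arch_pow_inv[of "1 / C" \<rho>] \<rho> by auto
  have "\<forall>x y. dist ((T ^^ N) x) ((T ^^ N) y) \<le> (C * \<rho> ^ N) * dist x y"
  proof (intro allI)
    fix x y
    have "norm ((T ^^ N) x - (T ^^ N) y)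
        \<le> CARD('n \<times> 'd) * block_max_norm ((T ^^ N) x - (T ^^ N) y)"
      by (rule norm_le_block_max_norm)
    also have "\<dots> \<le> CARD('n \<times> 'd) * (\<rho> ^ N * block_max_norm (x - y))"
      by (intro mult_left_mono steps) simp
    also have "\<dots> \<le> CARD('n \<times> 'd) * (\<rho> ^ N * (CARD('d) * norm (x - y)))"
      using \<rho>(1) by (intro mult_left_mono block_max_norm_le_norm) auto
    finally show "dist ((T ^^ N) x) ((T ^^ N) y) \<le> (C * \<rho> ^ N) * dist x y"
      by (simp add: C_def dist_norm mult_ac)
  qed
  moreover have "0 \<le> C * \<rho> ^ N" "C * \<rho> ^ N < 1"
    using N \<open>C > 0\<close> \<rho>(1) by (simp_all add: field_simps)
  ultimately have ex1: "\<exists>!x. (T ^^ N) x = x"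
    by (intro banach_fix_type)
  then obtain x where x: "(T ^^ N) x = x"
    by blast
  have "(T ^^ N) (T x) = T x"
    using x by (metis funpow_swap1)
  with x ex1 have "x = T x"
    by metis
  moreover have "y = T y \<Longrightarrow> y = x" for y
  proof -
    assume "y = T y"
    then have "(T ^^ N) y = y"
      by (induction N) simp_all
    with x ex1 show "y = x"
      by metis
  qed
  ultimately show ?thesis
    by blast
qed

text \<open>The induction over the windows shows that from iteration \<open>m * (B + D + 1)\<close> on, and not only
  at this iteration, every block has error at most \<open>\<rho> ^ m\<close> times the initial one: delayed
  blocks are used later, so the bound must have become permanent.\<close>

lemma block_contraction_async_rate:
  fixes x :: "nat \<Rightarrow> real ^ ('n::finite \<times> 'd::finite)"
  assumes U: "block_contraction E \<rho> U" and \<rho>: "0 \<le> \<rho>" "\<rho> < 1"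
    and delays: "valid_delays E s" and async: "partial_asynchrony E K s B D"
    and x: "\<And>i k. block (x (Suc k)) i =
              (if k \<in> K i then U i (\<lambda>j. block (x (s i j k)) j) else block (x k) i)"
    and xs: "\<And>i. block xs i = U i (block xs)"
  shows "block_max_norm (x k - xs) \<le> \<rho> ^ (k div (B + D + 1)) * block_max_norm (x 0 - xs)"
proof -
  define e where "e k i = norm (block (x k - xs) i)" for k i
  define M where "M = block_max_norm (x 0 - xs)"
  define w where "w = B + D + 1"
  have "0 \<le> M"
    unfolding M_def by (rule block_max_norm_nonneg)
  have idle: "e (Suc k) i = e k i" if "k \<notin> K i" for k i
    using that by (simp add: e_def block_diff x)
  have update: "e (Suc k) i \<le> \<rho> * C"
    if "k \<in> K i" and "\<And>j. j \<in> closed_neighbours E i \<Longrightarrow> e (s i j k) j \<le> C" for k i C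
  proof -
    have "norm (U i (\<lambda>j. block (x (s i j k)) j) - U i (block xs)) \<le> \<rho> * C"
      using U that(2) unfolding block_contraction_def e_def block_diff by simp
    then show ?thesis
      using that(1) xs[of i] by (simp add: e_def block_diff x)
  qed
  have past: "s i j k \<le> k" if "j \<in> closed_neighbours E i" for i j k
    using that delays by (auto simp: closed_neighbours_def valid_delays_def)
  have recent: "k \<le> s i j k + D" if "j \<in> closed_neighbours E i" "k \<in> K i" for i j k
    using that delays async
    by (fastforce simp: closed_neighbours_def valid_delays_def partial_asynchrony_def)
  have initial: "e k i \<le> M" for k i
  proof (induction k arbitrary: i rule: less_induct)
    case (less k)
    show ?case
    proof (cases k)
      case 0
      then show ?thesis
        by (simp add: e_def M_def norm_block_le)
    next
      case (Suc k')
      show ?thesis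
      proof (cases "k' \<in> K i")
        case True
        have "e (Suc k') i \<le> \<rho> * M"
          using True by (rule update) (use less Suc past le_imp_less_Suc in blast)
        also have "\<dots> \<le> M"
          using \<rho> \<open>0 \<le> M\<close> by (simp add: mult_left_le_one_le)
        finally show ?thesis
          using Suc by simp
      next
        case False
        then show ?thesis
          using Suc less idle by simp
      qed
    qed
  qed
  have window: "e k i \<le> \<rho> ^ m * M" if "m * w \<le> k" for k m i
    using that
  proof (induction m arbitrary: k i)
    case 0
    then show ?case
      using initial by simp
  next
    case (Suc m)
    have fresh: "e (Suc k) i \<le> \<rho> ^ Suc m * M" if "k \<in> K i" "m * w + D \<le> k" for k
    proof -
      have "m * w \<le> s i j k" if "j \<in> closed_neighbours E i" for j
        using recent[OF that \<open>k \<in> K i\<close>] \<open>m * w + D \<le> k\<close> by linarith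
      then have "e (Suc k) i \<le> \<rho> * (\<rho> ^ m * M)"
        using \<open>k \<in> K i\<close> by (intro update Suc.IH)
      then show ?thesis
        by (simp add: mult.assoc)
    qed
    obtain k0 where k0: "k0 \<in> K i" "m * w + D \<le> k0" "k0 \<le> m * w + D + B"
      using async unfolding partial_asynchrony_def by fastforce
    have "e k i \<le> \<rho> ^ Suc m * M" if "Suc k0 \<le> k" for k
      using that
    proof (induction k rule: dec_induct)
      case base
      show ?case
        using k0 by (intro fresh)
    next
      case (step k)
      show ?case
      proof (cases "k \<in> K i")
        case True
        then show ?thesis
          using step k0 by (intro fresh) auto
      next
        case False
        then show ?thesis
          using step idle by simp
      qed
    qed
    moreover have "Suc k0 \<le> k"
      using k0 Suc.prems by (simp add: w_def)
    ultimately show ?case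
      by blast
  qed
  have "e k i \<le> \<rho> ^ (k div w) * M" for i
    by (rule window) simp
  then show ?thesis
    unfolding block_max_norm_le_iff e_def M_def w_def by blast
qed

section \<open>The updates of DGD and DGD-ATC\<close>

definition dgd_update ::
  "real ^ 'n ^ 'n \<Rightarrow> ('n::finite \<Rightarrow> real ^ 'd::finite \<Rightarrow> real) \<Rightarrow> real \<Rightarrow> 'n \<Rightarrow>
    ('n \<Rightarrow> real ^ 'd) \<Rightarrow> real ^ 'd" where
  "dgd_update W f \<alpha> i y = (\<Sum>j\<in>UNIV. W $ i $ j *\<^sub>R y j) - \<alpha> *\<^sub>R gradient (f i) (y i)"

definition dgd_atc_update ::
  "real ^ 'n ^ 'n \<Rightarrow> ('n::finite \<Rightarrow> real ^ 'd::finite \<Rightarrow> real) \<Rightarrow> real \<Rightarrow> 'n \<Rightarrow>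
    ('n \<Rightarrow> real ^ 'd) \<Rightarrow> real ^ 'd" where
  "dgd_atc_update W f \<alpha> i y = (\<Sum>j\<in>UNIV. W $ i $ j *\<^sub>R (y j - \<alpha> *\<^sub>R gradient (f j) (y j)))"

lemma block_gradient_stacked_objective:
  fixes f :: "'n::finite \<Rightarrow> real ^ 'd::finite \<Rightarrow> real"
  assumes diff: "\<And>i y. f i differentiable (at y)"
  shows "block (gradient (stacked_objective f) x) i = gradient (f i) (block x i)"
proof -
  define D :: "real ^ ('n \<times> 'd)"
    where "D = (\<chi> p. gradient (f (fst p)) (block x (fst p)) $ snd p)"
  have block_D: "block D i = gradient (f i) (block x i)" for i
    by (simp add: D_def block_def vec_eq_iff)
  have inner_blocks: "h \<bullet> D = (\<Sum>i\<in>UNIV. block h i \<bullet> block D i)" for h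
    by (simp add: inner_vec_def block_def sum.cartesian_product)
  have "linear (\<lambda>h :: real ^ ('n \<times> 'd). block h i)" for i
    by (rule linearI) (simp_all add: block_def vec_eq_iff)
  then have block: "((\<lambda>z :: real ^ ('n \<times> 'd). block z i) has_derivative (\<lambda>h. block h i)) (at x)" for i
    by (rule linear_imp_has_derivative)
  have "((\<lambda>z. f i (block z i)) has_derivative (\<lambda>h. block h i \<bullet> block D i)) (at x)" for i
    using has_derivative_compose[OF block
        differentiable_imp_GDERIV_gradient[OF diff, unfolded gderiv_def]]
    unfolding block_D .
  then have "(stacked_objective f has_derivative (\<lambda>h. h \<bullet> D)) (at x)"
    unfolding stacked_objective_def[abs_def] inner_blocks by (intro has_derivative_sum)
  then have "gradient (stacked_objective f) x = D"
    by (intro gradient_eqI) (simp add: gderiv_def)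
  then show ?thesis
    by (simp add: block_D)
qed

lemma block_scaleR: "block (c *\<^sub>R x) i = c *\<^sub>R block x i"
  by (simp add: block_def vec_eq_iff)

lemma block_dgd_map:
  assumes "\<And>i y. f i differentiable (at y)"
  shows "block (dgd_map W f \<alpha> x) i = dgd_update W f \<alpha> i (block x)"
  by (simp add: dgd_map_def dgd_update_def block_diff block_scaleR block_kronecker_mat_1
      block_gradient_stacked_objective[of f, OF assms])

lemma block_dgd_atc_map:
  assumes "\<And>i y. f i differentiable (at y)"
  shows "block (dgd_atc_map W f \<alpha> x) i = dgd_atc_update W f \<alpha> i (block x)"
  by (simp add: dgd_atc_map_def dgd_atc_update_def block_diff block_scaleR block_kronecker_mat_1
      block_gradient_stacked_objective[of f, OF assms])

lemma averaging_matrix_nonneg: "averaging_matrix E W \<Longrightarrow> 0 \<le> W $ i $ j"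
  by (simp add: averaging_matrix_def)

lemma averaging_matrix_row_sum: "averaging_matrix E W \<Longrightarrow> (\<Sum>j\<in>UNIV. W $ i $ j) = 1"
  by (auto simp: averaging_matrix_def matrix_vector_mult_def vec_eq_iff)

lemma averaging_matrix_diagonal_pos: "averaging_matrix E W \<Longrightarrow> 0 < W $ i $ i"
  by (auto simp: averaging_matrix_def less_le)

lemma averaging_matrix_diagonal_le_1: "averaging_matrix E W \<Longrightarrow> W $ i $ i \<le> 1"
  using member_le_sum[of i UNIV "\<lambda>j. W $ i $ j"]
  by (simp add: averaging_matrix_nonneg averaging_matrix_row_sum)

lemma averaging_matrix_outside_neighbourhood:
  "averaging_matrix E W \<Longrightarrow> j \<notin> closed_neighbours E i \<Longrightarrow> W $ i $ j = 0"
  by (auto simp: averaging_matrix_def closed_neighbours_def neighbours_def)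

lemma sum_closed_neighbours:
  fixes y :: "'n::finite \<Rightarrow> 'a::real_vector"
  assumes "averaging_matrix E W"
  shows "(\<Sum>j\<in>closed_neighbours E i. W $ i $ j *\<^sub>R y j) = (\<Sum>j\<in>UNIV. W $ i $ j *\<^sub>R y j)"
  by (rule sum.mono_neutral_left) (auto simp: averaging_matrix_outside_neighbourhood[OF assms])

lemma norm_weighted_sum_le:
  assumes W: "averaging_matrix E W"
    and le: "\<And>j. j \<in> closed_neighbours E i \<Longrightarrow> j \<in> S \<Longrightarrow> norm (y j) \<le> M"
  shows "norm (\<Sum>j\<in>S. W $ i $ j *\<^sub>R y j) \<le> (\<Sum>j\<in>S. W $ i $ j) * M"
proof -
  have "norm (\<Sum>j\<in>S. W $ i $ j *\<^sub>R y j) \<le> (\<Sum>j\<in>S. W $ i $ j * M)"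
  proof (rule sum_norm_le)
    fix j assume "j \<in> S"
    show "norm (W $ i $ j *\<^sub>R y j) \<le> W $ i $ j * M"
    proof (cases "j \<in> closed_neighbours E i")
      case True
      then show ?thesis
        using le \<open>j \<in> S\<close> averaging_matrix_nonneg[OF W] by (simp add: mult_left_mono)
    next
      case False
      then show ?thesis
        using averaging_matrix_outside_neighbourhood[OF W] by simp
    qed
  qed
  then show ?thesis
    by (simp add: sum_distrib_right)
qed

text \<open>The gradient term is merged with the own block, which thereby contributes \<open>w\<close> times a
  gradient step of length \<open>\<alpha> / w\<close>.  Its squared length is at most
  \<open>1 - (\<alpha> / w) \<mu> (2 - \<alpha> L / w)\<close> times \<open>M\<^sup>2\<close>; averaging the squares with the other blocks, of
  total weight \<open>1 - w\<close>, multiplies the gain by \<open>w\<close>.\<close>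

lemma block_contraction_dgd:
  fixes f :: "'n::finite \<Rightarrow> real ^ 'd::finite \<Rightarrow> real"
  assumes W: "averaging_matrix E W"
    and L: "\<And>i. L i > 0" "\<And>i. L_smooth (L i) (f i)"
    and \<mu>: "\<And>i. \<mu> i > 0" "\<And>i. strongly_convex (\<mu> i) (f i)"
    and \<alpha>: "\<alpha> > 0" "\<And>i. \<alpha> * L i < 2 * W $ i $ i"
    and \<rho>: "0 \<le> \<rho>" "\<And>i. 1 - \<alpha> * \<mu> i * (2 - \<alpha> * L i / W $ i $ i) \<le> \<rho>\<^sup>2"
  shows "block_contraction E \<rho> (dgd_update W f \<alpha>)"
  unfolding block_contraction_def
proof (intro allI impI)
  fix i and y z :: "'n \<Rightarrow> real ^ 'd" and M
  assume M: "\<forall>j\<in>closed_neighbours E i. norm (y j - z j) \<le> M"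
  define w where "w = W $ i $ i"
  define \<beta> where "\<beta> = \<alpha> / w"
  define a where "a = (y i - \<beta> *\<^sub>R gradient (f i) (y i)) - (z i - \<beta> *\<^sub>R gradient (f i) (z i))"
  define b where "b = (\<Sum>j\<in>UNIV - {i}. W $ i $ j *\<^sub>R (y j - z j))"
  define q where "q = 1 - \<beta> * \<mu> i * (2 - \<beta> * L i)"
  have w: "0 < w" "w \<le> 1"
    unfolding w_def using W by (rule averaging_matrix_diagonal_pos averaging_matrix_diagonal_le_1)+
  have own: "norm (y i - z i) \<le> M"
    using M by (simp add: closed_neighbours_def)
  then have "0 \<le> M"
    using norm_ge_zero order_trans by blast
  have \<beta>: "\<beta> > 0" "\<beta> * L i < 2"
    using w \<alpha>(1) \<alpha>(2)[of i] by (simp_all add: \<beta>_def field_simps flip: w_def)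
  have "\<mu> i \<le> L i"
    using L \<mu> strongly_convex_modulus_le_smoothness by blast
  then have "0 \<le> q"
    using contraction_factor_term(2)[of \<beta> "\<mu> i" "L i" 1] \<beta> \<mu>(1) by (simp add: q_def mult.assoc)
  have "(norm a)\<^sup>2 \<le> q * (norm (y i - z i))\<^sup>2"
    unfolding a_def q_def using L \<mu> \<beta> by (intro gradient_step_contracts)
  also have "\<dots> \<le> q * M\<^sup>2"
    using own \<open>0 \<le> q\<close> by (intro mult_left_mono power_mono) auto
  finally have a: "(norm a)\<^sup>2 \<le> q * M\<^sup>2" .
  have "norm b \<le> (\<Sum>j\<in>UNIV - {i}. W $ i $ j) * M"
    unfolding b_def using M by (intro norm_weighted_sum_le[OF W]) auto
  also have "(\<Sum>j\<in>UNIV - {i}. W $ i $ j) = 1 - w"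
    using averaging_matrix_row_sum[OF W, of i] sum.remove[of UNIV i "\<lambda>j. W $ i $ j"]
    by (simp add: w_def)
  finally have b: "norm b \<le> (1 - w) * M" .
  have "dgd_update W f \<alpha> i y - dgd_update W f \<alpha> i z
      = (\<Sum>j\<in>UNIV. W $ i $ j *\<^sub>R (y j - z j)) - \<alpha> *\<^sub>R (gradient (f i) (y i) - gradient (f i) (z i))"
    by (simp add: dgd_update_def sum_subtractf scaleR_diff_right)
  also have "\<dots> = w *\<^sub>R (y i - z i) + b - \<alpha> *\<^sub>R (gradient (f i) (y i) - gradient (f i) (z i))"
    by (simp add: sum.remove[of UNIV i] w_def b_def)
  also have "\<dots> = w *\<^sub>R a + b"
    using w by (simp add: a_def \<beta>_def algebra_simps)
  finally have "norm (dgd_update W f \<alpha> i y - dgd_update W f \<alpha> i z) \<le> norm (w *\<^sub>R a) + norm b"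
    by (simp add: norm_triangle_ineq del: norm_scaleR)
  also have "\<dots> \<le> w * norm a + (1 - w) * M"
    using b w by simp
  also have "\<dots> \<le> \<rho> * M"
  proof (rule power2_le_imp_le)
    \<comment> \<open>convexity of the square: the defect is \<open>w (1 - w) (norm a - M)\<^sup>2\<close>\<close>
    have "(w * norm a + (1 - w) * M)\<^sup>2 = w * (norm a)\<^sup>2 + (1 - w) * M\<^sup>2 - w * (1 - w) * (norm a - M)\<^sup>2"
      by (simp add: power2_eq_square algebra_simps)
    also have "\<dots> \<le> w * (norm a)\<^sup>2 + (1 - w) * M\<^sup>2"
      using w by simp
    also have "\<dots> \<le> w * (q * M\<^sup>2) + (1 - w) * M\<^sup>2"
      using a w by simp
    also have "\<dots> = (1 - w * (1 - q)) * M\<^sup>2"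
      by (simp add: algebra_simps)
    also have "w * (1 - q) = \<alpha> * \<mu> i * (2 - \<alpha> * L i / w)"
      using w by (simp add: q_def \<beta>_def)
    also have "(1 - \<alpha> * \<mu> i * (2 - \<alpha> * L i / w)) * M\<^sup>2 \<le> \<rho>\<^sup>2 * M\<^sup>2"
      using \<rho>(2) unfolding w_def by (intro mult_right_mono) auto
    finally show "(w * norm a + (1 - w) * M)\<^sup>2 \<le> (\<rho> * M)\<^sup>2"
      by (simp add: power_mult_distrib)
  qed (use \<rho>(1) \<open>0 \<le> M\<close> in simp)
  finally show "norm (dgd_update W f \<alpha> i y - dgd_update W f \<alpha> i z) \<le> \<rho> * M" .
qed

lemma block_contraction_dgd_atc:
  fixes f :: "'n::finite \<Rightarrow> real ^ 'd::finite \<Rightarrow> real"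
  assumes W: "averaging_matrix E W"
    and L: "\<And>i. L i > 0" "\<And>i. L_smooth (L i) (f i)"
    and \<mu>: "\<And>i. \<mu> i > 0" "\<And>i. strongly_convex (\<mu> i) (f i)"
    and \<alpha>: "\<alpha> > 0" "\<And>i. \<alpha> * L i < 2"
    and \<rho>: "0 \<le> \<rho>" "\<And>i. 1 - \<alpha> * \<mu> i * (2 - \<alpha> * L i) \<le> \<rho>\<^sup>2"
  shows "block_contraction E \<rho> (dgd_atc_update W f \<alpha>)"
  unfolding block_contraction_def
proof (intro allI impI)
  fix i and y z :: "'n \<Rightarrow> real ^ 'd" and M
  assume M: "\<forall>j\<in>closed_neighbours E i. norm (y j - z j) \<le> M"
  define step where "step j u = u - \<alpha> *\<^sub>R gradient (f j) u" for j u
  have step: "norm (step j (y j) - step j (z j)) \<le> \<rho> * M" if "j \<in> closed_neighbours E i" for j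
  proof (rule power2_le_imp_le)
    have le: "norm (y j - z j) \<le> M"
      using M that by blast
    then have "0 \<le> M"
      using norm_ge_zero order_trans by blast
    with \<rho>(1) show "0 \<le> \<rho> * M"
      by simp
    have "(norm (step j (y j) - step j (z j)))\<^sup>2
        \<le> (1 - \<alpha> * \<mu> j * (2 - \<alpha> * L j)) * (norm (y j - z j))\<^sup>2"
      unfolding step_def using L \<mu> \<alpha> by (intro gradient_step_contracts)
    also have "\<dots> \<le> \<rho>\<^sup>2 * M\<^sup>2"
      using \<rho>(2) le by (intro mult_mono power_mono) auto
    finally show "(norm (step j (y j) - step j (z j)))\<^sup>2 \<le> (\<rho> * M)\<^sup>2"
      by (simp add: power_mult_distrib)
  qed
  have "dgd_atc_update W f \<alpha> i y - dgd_atc_update W f \<alpha> i z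
      = (\<Sum>j\<in>UNIV. W $ i $ j *\<^sub>R (step j (y j) - step j (z j)))"
    by (simp add: dgd_atc_update_def step_def sum_subtractf scaleR_diff_right)
  also have "norm \<dots> \<le> (\<Sum>j\<in>UNIV. W $ i $ j) * (\<rho> * M)"
    by (intro norm_weighted_sum_le[OF W] step)
  finally show "norm (dgd_atc_update W f \<alpha> i y - dgd_atc_update W f \<alpha> i z) \<le> \<rho> * M"
    by (simp add: averaging_matrix_row_sum[OF W])
qed

section \<open>Linear convergence of the asynchronous methods\<close>

theorem theorem2:
  fixes E :: "'n::finite set set"
    and W :: "real ^ 'n ^ 'n"
    and f :: "'n \<Rightarrow> real ^ 'd::finite \<Rightarrow> real"
    and L \<mu> :: "'n \<Rightarrow> real"
    and K :: "'n \<Rightarrow> nat set"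
    and s :: "'n \<Rightarrow> 'n \<Rightarrow> nat \<Rightarrow> nat"
    and B D :: nat
    and \<alpha> :: real
  assumes graph: "simple_graph E" "graph_connected E"
    and W: "averaging_matrix E W"
    and proper: "\<And>i. proper_function (\<lambda>y. ereal (f i y))"
    and closed: "\<And>i. closed_function (f i)"
    and convex: "\<And>i. convex_on UNIV (f i)"
    and lower_bounded: "\<And>i. bdd_below (range (f i))"
    and L_pos: "\<And>i. L i > 0"
    and smooth: "\<And>i. L_smooth (L i) (f i)"
    and mu_pos: "\<And>i. \<mu> i > 0"
    and strongly: "\<And>i. strongly_convex (\<mu> i) (f i)"
    and opt_nonempty: "optimal_solutions (\<lambda>y. \<Sum>i\<in>UNIV. f i y) \<noteq> {}"
    and opt_bounded: "bounded (optimal_solutions (\<lambda>y. \<Sum>i\<in>UNIV. f i y))"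
    and delays: "valid_delays E s"
    and BD_pos: "B > 0" "D > 0"
    and async: "partial_asynchrony E K s B D"
  shows
    "(\<alpha> \<in> {0<..<2 * Min (range (\<lambda>i. W $ i $ i / L i))} \<longrightarrow>
        0 \<le> rho_dgd W \<mu> L \<alpha> \<and> rho_dgd W \<mu> L \<alpha> < 1 \<and>
        (rho_dgd W \<mu> L \<alpha> = 0 \<longleftrightarrow> (\<forall>i. W $ i $ i = 1 \<and> \<mu> i = L i \<and> \<alpha> = 1 / L i)) \<and>
        (\<exists>!xs. xs = dgd_map W f \<alpha> xs) \<and>
        (\<forall>x xs. async_dgd E W f \<alpha> K s x \<longrightarrow> xs = dgd_map W f \<alpha> xs \<longrightarrow>
           (\<forall>k. block_max_norm (x k - xs)
                \<le> rho_dgd W \<mu> L \<alpha> ^ (k div (B + D + 1)) * block_max_norm (x 0 - xs)))) \<and>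
     (\<alpha> \<in> {0<..<2 / Max (range L)} \<longrightarrow>
        0 \<le> rho_dgd_atc \<mu> L \<alpha> \<and> rho_dgd_atc \<mu> L \<alpha> < 1 \<and>
        (rho_dgd_atc \<mu> L \<alpha> = 0 \<longleftrightarrow> (\<forall>i. \<mu> i = L i \<and> \<alpha> = 1 / L i)) \<and>
        (\<exists>!xs. xs = dgd_atc_map W f \<alpha> xs) \<and>
        (\<forall>x xs. async_dgd_atc E W f \<alpha> K s x \<longrightarrow> xs = dgd_atc_map W f \<alpha> xs \<longrightarrow>
           (\<forall>k. block_max_norm (x k - xs)
                \<le> rho_dgd_atc \<mu> L \<alpha> ^ (k div (B + D + 1)) * block_max_norm (x 0 - xs))))"
proof -
  have diff: "f i differentiable (at y)" for i y
    using smooth unfolding L_smooth_def by blast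
  have mu_le: "\<mu> i \<le> L i" for i
    using smooth strongly by (rule strongly_convex_modulus_le_smoothness)
  note diagonal = averaging_matrix_diagonal_pos[OF W] averaging_matrix_diagonal_le_1[OF W]
  show ?thesis
  proof (intro conjI[of "_ \<longrightarrow> _"] impI)
    let ?\<rho> = "rho_dgd W \<mu> L \<alpha>" and ?U = "dgd_update W f \<alpha>"
    assume \<alpha>: "\<alpha> \<in> {0<..<2 * Min (range (\<lambda>i. W $ i $ i / L i))}"
    then have "\<alpha> > 0"
      by simp
    have step_size: "\<alpha> * L i < 2 * W $ i $ i" for i
    proof -
      have "Min (range (\<lambda>i. W $ i $ i / L i)) \<le> W $ i $ i / L i"
        by (rule Min_le) auto
      moreover have "\<alpha> < 2 * Min (range (\<lambda>i. W $ i $ i / L i))"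
        using \<alpha> by simp
      ultimately have "\<alpha> < 2 * (W $ i $ i / L i)"
        by linarith
      then show ?thesis
        using L_pos[of i] by (simp add: field_simps)
    qed
    note \<rho> = contraction_factor[of \<alpha> \<mu> L "\<lambda>i. W $ i $ i",
        OF \<open>\<alpha> > 0\<close> mu_pos mu_le diagonal step_size, folded rho_dgd_def]
    have U: "block_contraction E ?\<rho> ?U"
      using W L_pos smooth mu_pos strongly \<open>\<alpha> > 0\<close> step_size \<rho>(1) \<rho>(4)
      by (rule block_contraction_dgd)
    note map = block_dgd_map[of f W \<alpha>, OF diff]
    have "\<exists>!xs. xs = dgd_map W f \<alpha> xs"
      using U \<rho>(1,2) map by (rule block_contraction_unique_fixpoint)
    moreover have "block_max_norm (x k - xs) \<le> ?\<rho> ^ (k div (B + D + 1)) * block_max_norm (x 0 - xs)"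
      if x: "async_dgd E W f \<alpha> K s x" and xs: "xs = dgd_map W f \<alpha> xs" for x xs k
    proof (rule block_contraction_async_rate[OF U \<rho>(1,2) delays async])
      have "s i i k = k" for i k
        using delays by (simp add: valid_delays_def)
      then show "block (x (Suc k)) i =
          (if k \<in> K i then ?U i (\<lambda>j. block (x (s i j k)) j) else block (x k) i)" for i k
        using x by (simp add: async_dgd_def dgd_update_def sum_closed_neighbours[OF W])
      show "block xs i = ?U i (block xs)" for i
        using map xs by metis
    qed
    ultimately show "0 \<le> ?\<rho> \<and> ?\<rho> < 1 \<and>
        (?\<rho> = 0 \<longleftrightarrow> (\<forall>i. W $ i $ i = 1 \<and> \<mu> i = L i \<and> \<alpha> = 1 / L i)) \<and>
        (\<exists>!xs. xs = dgd_map W f \<alpha> xs) \<and>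
        (\<forall>x xs. async_dgd E W f \<alpha> K s x \<longrightarrow> xs = dgd_map W f \<alpha> xs \<longrightarrow>
           (\<forall>k. block_max_norm (x k - xs)
                \<le> ?\<rho> ^ (k div (B + D + 1)) * block_max_norm (x 0 - xs)))"
      using \<rho>(1-3) by blast
  next
    let ?\<rho> = "rho_dgd_atc \<mu> L \<alpha>" and ?U = "dgd_atc_update W f \<alpha>"
    assume \<alpha>: "\<alpha> \<in> {0<..<2 / Max (range L)}"
    then have "\<alpha> > 0"
      by simp
    have step_size: "\<alpha> * L i < 2" for i
    proof -
      have "L i \<le> Max (range L)"
        by (rule Max_ge) auto
      moreover have "\<alpha> * Max (range L) < 2"
        using \<alpha> L_pos[of i] calculation by (simp add: field_simps)
      ultimately show ?thesis
        using \<open>\<alpha> > 0\<close> by (meson less_imp_le mult_left_mono order_le_less_trans)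
    qed
    note \<rho> = contraction_factor[of \<alpha> \<mu> L "\<lambda>_. 1", OF \<open>\<alpha> > 0\<close> mu_pos mu_le,
        unfolded div_by_1 mult_1_right, OF zero_less_one order_refl step_size,
        folded rho_dgd_atc_def]
    have U: "block_contraction E ?\<rho> ?U"
      using W L_pos smooth mu_pos strongly \<open>\<alpha> > 0\<close> step_size \<rho>(1) \<rho>(4)
      by (rule block_contraction_dgd_atc)
    note map = block_dgd_atc_map[of f W \<alpha>, OF diff]
    have "\<exists>!xs. xs = dgd_atc_map W f \<alpha> xs"
      using U \<rho>(1,2) map by (rule block_contraction_unique_fixpoint)
    moreover have "block_max_norm (x k - xs) \<le> ?\<rho> ^ (k div (B + D + 1)) * block_max_norm (x 0 - xs)"
      if x: "async_dgd_atc E W f \<alpha> K s x" and xs: "xs = dgd_atc_map W f \<alpha> xs" for x xs k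
    proof (rule block_contraction_async_rate[OF U \<rho>(1,2) delays async])
      show "block (x (Suc k)) i =
          (if k \<in> K i then ?U i (\<lambda>j. block (x (s i j k)) j) else block (x k) i)" for i k
        using x by (simp add: async_dgd_atc_def dgd_atc_update_def sum_closed_neighbours[OF W])
      show "block xs i = ?U i (block xs)" for i
        using map xs by metis
    qed
    ultimately show "0 \<le> ?\<rho> \<and> ?\<rho> < 1 \<and>
        (?\<rho> = 0 \<longleftrightarrow> (\<forall>i. \<mu> i = L i \<and> \<alpha> = 1 / L i)) \<and>
        (\<exists>!xs. xs = dgd_atc_map W f \<alpha> xs) \<and>
        (\<forall>x xs. async_dgd_atc E W f \<alpha> K s x \<longrightarrow> xs = dgd_atc_map W f \<alpha> xs \<longrightarrow>
           (\<forall>k. block_max_norm (x k - xs)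
                \<le> ?\<rho> ^ (k div (B + D + 1)) * block_max_norm (x 0 - xs)))"
      using \<rho>(1-3) by blast
  qed
qed

end
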